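(* For any $s\leq -1/4$ and any $a,b\in\mathbb{R}$ with $a<1/2$, the estimate $$\left\|\left(\frac{|\xi|^2\,\widetilde{uv}(\tau,\xi)}{2i\gamma(\xi)}\right)^{\sim^{-1}}\right\|_{X_{s,-a}}\leq c\,\|u\|_{X_{s,b}}\,\|v\|_{X_{s,b}}$$ fails; that is, there is no constant $c>0$ such that this inequality holds for all $u,v\in X_{s,b}$.
   Context: Write $\langle a\rangle = 1+|a|$ and $\gamma(\xi)=\sqrt{\xi^2+\xi^4}$ for $\xi\in\mathbb{R}$. The symbol $\widetilde{F}(\tau,\xi)$ denotes the time-space Fourier transform of $F(t,x)$ on $\mathbb{R}^2$ ($\tau$ dual to $t$, $\xi$ dual to $x$), and $\sim^{-1}$ its inverse. For $s,b\in\mathbb{R}$, $X_{s,b}$ is the completion of the Schwartz class $\mathcal{S}(\mathbb{R}^2)$ with respect to the norm $$\|F\|_{X_{s,b}}=\big\|\langle|\tau|-\gamma(\xi)\rangle^b\langle\xi\rangle^s\,\widetilde{F}(\tau,\xi)\big\|_{L^2_{\tau,\xi}}.$$ The product $uv$ is understood through its Fourier transform $\widetilde{uv}=\widetilde u * \widetilde v$ (convolution in $(\tau,\xi)$, up to the normalization constant of the Fourier transform). *)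

theory Defs
  imports "HOL-Analysis.Analysis"
begin

text \<open>
  Physical variables are pairs \<open>(t, x)\<close>, frequency variables are pairs \<open>(\<tau>, \<xi>)\<close>.
\<close>

definition japanese :: "real \<Rightarrow> real" where
  "japanese r = 1 + \<bar>r\<bar>"

definition disp :: "real \<Rightarrow> real" where
  "disp \<xi> = sqrt (\<xi>\<^sup>2 + \<xi> ^ 4)"

definition partial_t :: "(real \<times> real \<Rightarrow> complex) \<Rightarrow> real \<times> real \<Rightarrow> complex" where
  "partial_t f = (\<lambda>(t, x). vector_derivative (\<lambda>r. f (r, x)) (at t))"

definition partial_x :: "(real \<times> real \<Rightarrow> complex) \<Rightarrow> real \<times> real \<Rightarrow> complex" where
  "partial_x f = (\<lambda>(t, x). vector_derivative (\<lambda>r. f (t, r)) (at x))"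

text \<open>
  Total differentiability of all the iterated partial derivatives below makes \<open>f\<close> smooth, and
  then the order of differentiation does not matter, so one order suffices.
\<close>

definition schwartz :: "(real \<times> real \<Rightarrow> complex) set" where
  "schwartz = {f. \<forall>i j. let g = (partial_t ^^ i) ((partial_x ^^ j) f) in
      (\<forall>p. g differentiable (at p)) \<and>
      (\<forall>k l. bounded (range (\<lambda>(t, x). of_real (t ^ k * x ^ l) * g (t, x))))}"

definition fourier :: "(real \<times> real \<Rightarrow> complex) \<Rightarrow> real \<times> real \<Rightarrow> complex" where
  "fourier F = (\<lambda>(\<tau>, \<xi>). LINT (t, x)|lborel. exp (- \<i> * of_real (t * \<tau> + x * \<xi>)) * F (t, x))"

definition ennsqrt :: "ennreal \<Rightarrow> ennreal" where
  "ennsqrt y = (if y = \<infinity> then \<infinity> else ennreal (sqrt (enn2real y)))"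

text \<open>
  The norm of \<open>X\<^bsub>s,b\<^esub>\<close> as a function of the Fourier transform \<open>U\<close> of its argument.
  It takes the value \<open>\<infinity>\<close> outside the weighted \<open>L\<^sup>2\<close> space.
\<close>

definition X_norm :: "real \<Rightarrow> real \<Rightarrow> (real \<times> real \<Rightarrow> complex) \<Rightarrow> ennreal" where
  "X_norm s b U = ennsqrt (\<integral>\<^sup>+ (\<tau>, \<xi>).
      ennreal ((japanese (\<bar>\<tau>\<bar> - disp \<xi>) powr b * japanese \<xi> powr s * cmod (U (\<tau>, \<xi>)))\<^sup>2)
      \<partial>lborel)"

text \<open>
  Elements of the completion of the Schwartz class need not be functions of \<open>(t, x)\<close>, so they are
  represented by their Fourier transforms: the Fourier transform embeds the Schwartz class
  isometrically into a (complete) weighted \<open>L\<^sup>2\<close> space, and the completion is the closure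
  of the image. Functions that agree almost everywhere represent the same element.
\<close>

definition X_space :: "real \<Rightarrow> real \<Rightarrow> (real \<times> real \<Rightarrow> complex) set" where
  "X_space s b = {U \<in> borel_measurable borel.
      \<exists>\<phi>. (\<forall>n::nat. \<phi> n \<in> schwartz) \<and>
          (\<lambda>n. X_norm s b (\<lambda>p. U p - fourier (\<phi> n) p)) \<longlonglongrightarrow> 0}"

text \<open>
  The Fourier transform of the product \<open>u v\<close> in terms of the transforms \<open>U\<close> and \<open>V\<close> of
  the factors; the factor \<open>1 / (2 \<pi>)\<^sup>2\<close> is the one belonging to the normalization
  of \<open>fourier\<close>. Where the convolution integral does not converge absolutely, its value is 0.
\<close>

definition prod_hat ::
  "(real \<times> real \<Rightarrow> complex) \<Rightarrow> (real \<times> real \<Rightarrow> complex) \<Rightarrow> real \<times> real \<Rightarrow> complex" where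
  "prod_hat U V = (\<lambda>p. of_real (1 / (2 * pi)\<^sup>2) * (LINT q|lborel. U q * V (p - q)))"

text \<open>
  On the null set \<open>\<xi> = 0\<close> the quotient is \<open>0 / 0 = 0\<close>.
\<close>

definition bilinear_hat ::
  "(real \<times> real \<Rightarrow> complex) \<Rightarrow> (real \<times> real \<Rightarrow> complex) \<Rightarrow> real \<times> real \<Rightarrow> complex" where
  "bilinear_hat U V = (\<lambda>(\<tau>, \<xi>).
      of_real (\<bar>\<xi>\<bar>\<^sup>2) * prod_hat U V (\<tau>, \<xi>) / (2 * \<i> * of_real (disp \<xi>)))"

end

theory Submission
  imports Defs "HOL-Probability.Characteristic_Functions"
begin

text \<open>
  The failure comes from an interaction of two high frequencies that cancel to a low one. Let
  \<open>U\<close> be a bump of unit size near the point of the curve \<open>\<tau> = \<gamma>(\<xi>)\<close> with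
  \<open>\<xi> = N\<close>, and \<open>V\<close> the reflected bump near the curve \<open>\<tau> = - \<gamma>(\<xi>)\<close> at
  \<open>\<xi> = - N\<close>. If each bump stretches along the tangent of its curve, the modulation
  \<open>\<bar>\<tau>\<bar> - \<gamma>(\<xi>)\<close> is \<open>O(1)\<close> on it, so the norms of both factors are \<open>O(N\<^sup>s)\<close>, whatever
  \<open>b\<close> is. The two tangents are parallel with slope about \<open>2 N\<close>, so the convolution is a bump of
  unit size around the line \<open>\<tau> = 2 N \<xi>\<close>. There, for \<open>\<xi>\<close> between 1 and 2, the multiplier
  \<open>\<xi>\<^sup>2 / (2 \<gamma>(\<xi>))\<close> is bounded below while the modulation is comparable with \<open>N\<close>. Hence the
  left-hand side is at least a constant times \<open>N powr (- a)\<close>, and the estimate would give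
  \<open>N powr (- a) \<le> C * N powr (2 * s)\<close> for all large \<open>N\<close>. This is absurd because
  \<open>- a > - 1 / 2 \<ge> 2 * s\<close>.

  The bumps are taken to be sheared Gaussians. They are Fourier transforms of explicit Schwartz
  functions (\<open>packet_schwartz\<close>, \<open>fourier_packet\<close>), so they belong to every \<open>X_space s b\<close> without
  any density argument, and the shears reduce every integral to one that does not
  involve \<open>N\<close>, because they preserve Lebesgue measure (\<open>distr_shear\<close>). Since \<open>\<gamma>(\<xi>)\<close> differs from
  \<open>\<xi>\<^sup>2\<close> by at most \<open>1 / 2\<close>, the parabola can replace the curve throughout. The
  two sides of the contradiction are \<open>X_norm_packet_hat_le\<close> and \<open>X_norm_bilinear_packets_ge\<close>.
\<close>

section \<open>Gaussians and shears of the plane\<close>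

text \<open>
  Coordinates adapted to the line of slope \<open>m = d\<tau> / d\<xi>\<close> through \<open>(\<alpha>, \<beta>)\<close>: the first measures the
  vertical distance from the line, the second the position along it.
\<close>

definition shear :: "real \<Rightarrow> real \<Rightarrow> real \<Rightarrow> real \<times> real \<Rightarrow> real \<times> real" where
  "shear m \<alpha> \<beta> = (\<lambda>(\<tau>, \<xi>). (\<tau> - \<alpha> - m * (\<xi> - \<beta>), \<xi> - \<beta>))"

definition gauss :: "real \<Rightarrow> real" where
  "gauss r = exp (- r\<^sup>2 / 2)"

definition gauss2 :: "real \<times> real \<Rightarrow> real" where
  "gauss2 = (\<lambda>(\<sigma>, \<eta>). gauss \<sigma> * gauss \<eta>)"

lemma gauss_measurable [measurable]: "gauss \<in> borel_measurable borel"
  unfolding gauss_def by measurable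

lemma gauss2_measurable [measurable]: "gauss2 \<in> borel_measurable borel"
  unfolding gauss2_def borel_prod[symmetric] by measurable

lemma shear_measurable [measurable]: "shear m \<alpha> \<beta> \<in> borel_measurable borel"
  unfolding shear_def borel_prod[symmetric] by measurable

lemma gauss_pos: "0 < gauss r" and gauss_le_1: "gauss r \<le> 1"
  by (simp_all add: gauss_def)

lemma gauss2_pos: "0 < gauss2 p" and gauss2_le_1: "gauss2 p \<le> 1"
  using gauss_pos gauss_le_1 by (auto simp: gauss2_def case_prod_beta less_imp_le intro!: mult_le_one)

lemma gauss2_eq: "gauss2 (\<sigma>, \<eta>) = exp (- (\<sigma>\<^sup>2 + \<eta>\<^sup>2) / 2)"
  by (simp add: gauss2_def gauss_def exp_add[symmetric] field_simps)

lemma gauss_eq_density: "gauss r = sqrt (2 * pi) * std_normal_density r"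
  by (simp add: gauss_def std_normal_density_def)

lemma integrable_gauss: "integrable lborel gauss"
  unfolding gauss_eq_density[abs_def] by (intro integrable_mult_right integrable_normal_density) simp

text \<open>
  Up to the normalizing factor, the left-hand side is the characteristic function of the normal
  distribution at \<open>- \<sigma>\<close>.
\<close>

lemma fourier_gauss:
  "(LINT t|lborel. exp (- \<i> * of_real (t * \<sigma>)) * of_real (gauss t)) =
     complex_of_real (sqrt (2 * pi) * gauss \<sigma>)"
proof -
  have "complex_of_real (gauss \<sigma>) = char std_normal_distribution (- \<sigma>)"
    by (simp add: char_std_normal_distribution gauss_def)
  also have "\<dots> = (LINT t|lborel. std_normal_density t *\<^sub>R iexp (- \<sigma> * t))"
    unfolding char_def by (subst integral_density) (auto simp: mult.commute)
  finally have *: "complex_of_real (gauss \<sigma>) = (LINT t|lborel. std_normal_density t *\<^sub>R iexp (- \<sigma> * t))" .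
  have "(LINT t|lborel. exp (- \<i> * of_real (t * \<sigma>)) * of_real (gauss t))
      = (LINT t|lborel. of_real (sqrt (2 * pi)) * (std_normal_density t *\<^sub>R iexp (- \<sigma> * t)))"
    by (intro Bochner_Integration.integral_cong)
      (auto simp: gauss_eq_density scaleR_conv_of_real mult_ac)
  also have "\<dots> = of_real (sqrt (2 * pi)) * (LINT t|lborel. std_normal_density t *\<^sub>R iexp (- \<sigma> * t))"
    by (rule integral_mult_right_zero)
  finally show ?thesis
    unfolding * [symmetric] by simp
qed

lemma integrable_times:
  fixes f g :: "real \<Rightarrow> complex"
  assumes "integrable lborel f" "integrable lborel g"
  shows "integrable (lborel \<Otimes>\<^sub>M lborel) (\<lambda>(x, y). f x * g y)"
proof (rule lborel_pair.Fubini_integrable)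
  have [measurable]: "f \<in> borel_measurable lborel" "g \<in> borel_measurable lborel"
    using assms by auto
  show "(\<lambda>(x, y). f x * g y) \<in> borel_measurable (lborel \<Otimes>\<^sub>M lborel)" by measurable
  show "integrable lborel (\<lambda>x. LINT y|lborel. norm (case (x, y) of (x, y) \<Rightarrow> f x * g y))"
    using assms by (simp add: norm_mult)
  show "AE x in lborel. integrable lborel (\<lambda>y. case (x, y) of (x, y) \<Rightarrow> f x * g y)"
    using assms by simp
qed

lemma integral_times:
  fixes f g :: "real \<Rightarrow> complex"
  assumes "integrable lborel f" "integrable lborel g"
  shows "(LINT (x, y)|lborel. f x * g y) = (LINT x|lborel. f x) * (LINT y|lborel. g y)"
  using lborel_pair.integral_fst'[OF integrable_times[OF assms]] by (simp add: lborel_prod)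

lemma integrable_gauss2: "integrable lborel gauss2"
proof -
  have "integrable lborel (\<lambda>x. complex_of_real (gauss x))"
    using integrable_gauss by (rule integrable_of_real)
  from integrable_times[OF this this]
  have "integrable lborel (\<lambda>p. complex_of_real (gauss2 p))"
    by (simp add: gauss2_def lborel_prod split_def)
  from integrable_Re[OF this] show ?thesis by simp
qed

text \<open>
  By Tonelli, integrate along the first coordinate before the second: for fixed \<open>y\<close> the map is a translation
  of the line, and what remains is a translation in \<open>y\<close>.
\<close>

lemma distr_shift_fst:
  fixes h :: "real \<Rightarrow> real"
  assumes [measurable]: "h \<in> borel_measurable borel"
  shows "distr lborel borel (\<lambda>(x, y). (x + h y, y + d)) = (lborel :: (real \<times> real) measure)"
proof (rule measure_eqI)
  fix A :: "(real \<times> real) set" assume "A \<in> sets (distr lborel borel (\<lambda>(x, y). (x + h y, y + d)))"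
  then have A': "A \<in> sets borel" by simp
  then have A [measurable]: "A \<in> sets (borel \<Otimes>\<^sub>M borel)" unfolding borel_prod .
  have M: "(\<lambda>(x, y). (x + h y, y + d)) \<in> lborel \<rightarrow>\<^sub>M (borel :: (real \<times> real) measure)"
    unfolding lborel_prod[symmetric] borel_prod[symmetric] by measurable
  have "emeasure (distr lborel borel (\<lambda>(x, y). (x + h y, y + d))) A
      = (\<integral>\<^sup>+ p. indicator A p \<partial>distr lborel borel (\<lambda>(x, y). (x + h y, y + d)))"
    using A' by simp
  also have "\<dots> = (\<integral>\<^sup>+ (x, y). indicator A (x + h y, y + d) \<partial>(lborel \<Otimes>\<^sub>M lborel))"
    using A' M by (subst nn_integral_distr) (auto simp: lborel_prod split_def)
  also have "\<dots> = (\<integral>\<^sup>+ y. \<integral>\<^sup>+ x. indicator A (x + h y, y + d) \<partial>lborel \<partial>lborel)"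
    by (subst lborel_pair.nn_integral_snd[symmetric]) (auto simp: case_prod_beta)
  also have "\<dots> = (\<integral>\<^sup>+ y. \<integral>\<^sup>+ x. indicator A (x, y + d) \<partial>lborel \<partial>lborel)"
  proof (rule nn_integral_cong)
    fix y
    show "(\<integral>\<^sup>+ x. indicator A (x + h y, y + d) \<partial>lborel) = (\<integral>\<^sup>+ x. indicator A (x, y + d) \<partial>lborel)"
      using nn_integral_real_affine[of "\<lambda>x. indicator A (x, y + d)" 1 "h y"] by (simp add: add.commute)
  qed
  also have "\<dots> = (\<integral>\<^sup>+ y. \<integral>\<^sup>+ x. indicator A (x, y) \<partial>lborel \<partial>lborel)"
    using nn_integral_real_affine[of "\<lambda>y. \<integral>\<^sup>+ x. indicator A (x, y) \<partial>lborel" 1 d]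
    by (simp add: add.commute)
  also have "\<dots> = (\<integral>\<^sup>+ p. indicator A p \<partial>(lborel \<Otimes>\<^sub>M lborel))"
    by (subst lborel_pair.nn_integral_snd[symmetric]) (auto simp: case_prod_beta)
  also have "\<dots> = emeasure lborel A" using A' by (simp add: lborel_prod)
  finally show "emeasure (distr lborel borel (\<lambda>(x, y). (x + h y, y + d))) A = emeasure lborel A" .
qed simp

lemma distr_shear: "distr lborel borel (shear m \<alpha> \<beta>) = lborel"
proof -
  have "shear m \<alpha> \<beta> = (\<lambda>(x, y). (x + (- \<alpha> - m * (y - \<beta>)), y + (- \<beta>)))"
    by (auto simp: shear_def)
  then show ?thesis by (simp only:) (rule distr_shift_fst, simp)
qed

text \<open>
  The shear that acts on physical space, obtained from the previous kind by exchanging the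
  coordinates.
\<close>

lemma distr_shear_snd: "distr lborel borel (\<lambda>(t, x). (t, x + m * t)) = (lborel :: (real \<times> real) measure)"
proof -
  let ?sw = "\<lambda>(x, y). (y, x) :: real \<times> real"
  have sw: "distr lborel borel ?sw = (lborel :: (real \<times> real) measure)"
  proof -
    have "distr (lborel \<Otimes>\<^sub>M lborel) (lborel \<Otimes>\<^sub>M lborel) ?sw = (lborel \<Otimes>\<^sub>M lborel :: (real \<times> real) measure)"
      by (rule lborel_pair.distr_pair_swap[symmetric])
    moreover have "distr (lborel \<Otimes>\<^sub>M lborel) (lborel \<Otimes>\<^sub>M lborel) ?sw =
        distr lborel (borel :: (real \<times> real) measure) ?sw"
      by (rule distr_cong) (simp_all add: lborel_prod, unfold borel_prod, rule refl)
    ultimately show ?thesis by (simp add: lborel_prod)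
  qed
  have sh: "distr lborel borel (\<lambda>(x, y). (x + m * y, y + 0)) = (lborel :: (real \<times> real) measure)"
    by (rule distr_shift_fst) simp
  have [measurable]: "?sw \<in> borel_measurable borel" "(\<lambda>(x, y). (x + m * y, y + 0)) \<in> borel \<rightarrow>\<^sub>M (borel :: (real \<times> real) measure)"
    unfolding borel_prod[symmetric] by measurable
  have "lborel = distr (distr (distr lborel borel ?sw) borel (\<lambda>(x, y). (x + m * y, y + 0))) borel ?sw"
    by (simp only: sw sh)
  also have "\<dots> = distr lborel borel (?sw \<circ> ((\<lambda>(x, y). (x + m * y, y + 0)) \<circ> ?sw))"
  proof -
    have "distr (distr lborel borel ?sw) borel (\<lambda>(x, y). (x + m * y, y + 0)) =
        distr lborel borel ((\<lambda>(x, y). (x + m * y, y + 0)) \<circ> ?sw)"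
      by (rule distr_distr) measurable
    moreover have "distr (distr lborel borel ((\<lambda>(x, y). (x + m * y, y + 0)) \<circ> ?sw)) borel ?sw =
        distr lborel borel (?sw \<circ> ((\<lambda>(x, y). (x + m * y, y + 0)) \<circ> ?sw))"
      by (rule distr_distr) measurable
    ultimately show ?thesis by simp
  qed
  also have "?sw \<circ> ((\<lambda>(x, y). (x + m * y, y + 0)) \<circ> ?sw) = (\<lambda>(t, x). (t, x + m * t))"
    by auto
  finally show ?thesis by simp
qed

section \<open>A criterion for Schwartz functions\<close>

text \<open>
  The polynomial multiples of \<open>E\<close>. When the logarithmic derivatives of \<open>E\<close> are affine, as for an
  exponential of a quadratic polynomial, this class is closed under differentiation, so one
  decay bound for the whole class controls all derivatives at once.
\<close>

inductive_set poly_multiples :: "(real \<times> real \<Rightarrow> complex) \<Rightarrow> (real \<times> real \<Rightarrow> complex) set"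
  for E where
  monom: "(\<lambda>p. c * of_real (fst p ^ i * snd p ^ j) * E p) \<in> poly_multiples E"
| add: "f \<in> poly_multiples E \<Longrightarrow> g \<in> poly_multiples E \<Longrightarrow> (\<lambda>p. f p + g p) \<in> poly_multiples E"

text \<open>
  Differentiating a monomial times \<open>E\<close> either lowers the degree of the monomial or multiplies it by the
  affine logarithmic derivative of \<open>E\<close>; both results are again polynomial multiples of \<open>E\<close>.
\<close>

lemma poly_multiples_deriv:
  assumes E: "\<And>p. (E has_derivative (\<lambda>h.
      (of_real (fst h) * (a0 + a1 * of_real (fst p) + a2 * of_real (snd p)) +
       of_real (snd h) * (b0 + b1 * of_real (fst p) + b2 * of_real (snd p))) * E p)) (at p)"
    and f: "f \<in> poly_multiples E"
  shows "\<exists>ft \<in> poly_multiples E. \<exists>fx \<in> poly_multiples E. \<forall>p.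
    (f has_derivative (\<lambda>h. of_real (fst h) * ft p + of_real (snd h) * fx p)) (at p)"
  using f
proof induction
  case (monom c i j)
  define M where "M = (\<lambda>c i j p. c * of_real (fst p ^ i * snd p ^ j) * E p)"
  have M: "M c i j \<in> poly_multiples E" for c i j
    unfolding M_def by (rule poly_multiples.monom)
  define ft where "ft = (\<lambda>p. M (c * of_nat i) (i - 1) j p +
      (M (c * a0) i j p + (M (c * a1) (Suc i) j p + M (c * a2) i (Suc j) p)))"
  define fx where "fx = (\<lambda>p. M (c * of_nat j) i (j - 1) p +
      (M (c * b0) i j p + (M (c * b1) (Suc i) j p + M (c * b2) i (Suc j) p)))"
  have "ft \<in> poly_multiples E" "fx \<in> poly_multiples E"
    unfolding ft_def fx_def by (intro poly_multiples.add M)+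
  moreover have "((\<lambda>p. c * of_real (fst p ^ i * snd p ^ j) * E p) has_derivative
      (\<lambda>h. of_real (fst h) * ft p + of_real (snd h) * fx p)) (at p)" for p
    by (rule derivative_eq_intros E refl | simp)+
      (auto simp: ft_def fx_def M_def algebra_simps)
  ultimately show ?case by blast
next
  case (add f g)
  then obtain ft fx gt gx where
    K: "ft \<in> poly_multiples E" "fx \<in> poly_multiples E" "gt \<in> poly_multiples E" "gx \<in> poly_multiples E"
    and f: "\<And>p. (f has_derivative (\<lambda>h. of_real (fst h) * ft p + of_real (snd h) * fx p)) (at p)"
    and g: "\<And>p. (g has_derivative (\<lambda>h. of_real (fst h) * gt p + of_real (snd h) * gx p)) (at p)"
    by blast
  have "((\<lambda>p. f p + g p) has_derivative
      (\<lambda>h. of_real (fst h) * (ft p + gt p) + of_real (snd h) * (fx p + gx p))) (at p)" for p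
    using has_derivative_add[OF f g, of p] by (simp add: algebra_simps)
  moreover have "(\<lambda>p. ft p + gt p) \<in> poly_multiples E" "(\<lambda>p. fx p + gx p) \<in> poly_multiples E"
    using K by (auto intro: poly_multiples.add)
  ultimately show ?case
    by (intro bexI[where x = "\<lambda>p. ft p + gt p"] bexI[where x = "\<lambda>p. fx p + gx p"]) auto
qed

lemma partials_eqI:
  assumes "\<And>p. (f has_derivative (\<lambda>h. of_real (fst h) * ft p + of_real (snd h) * fx p)) (at p)"
  shows "partial_t f = ft" "partial_x f = fx"
proof -
  have "((\<lambda>r. f (r, x)) has_vector_derivative ft (t, x)) (at t)" for t x
  proof -
    have "((\<lambda>r. (r, x)) has_derivative (\<lambda>h. (h, 0))) (at t)"
      by (auto intro!: derivative_eq_intros)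
    from has_derivative_compose[OF this assms[of "(t, x)"]] show ?thesis
      by (simp add: has_vector_derivative_def scaleR_conv_of_real)
  qed
  then show "partial_t f = ft"
    by (auto simp: partial_t_def fun_eq_iff intro!: vector_derivative_at)
  have "((\<lambda>r. f (t, r)) has_vector_derivative fx (t, x)) (at x)" for t x
  proof -
    have "((\<lambda>r. (t, r)) has_derivative (\<lambda>h. (0, h))) (at x)"
      by (auto intro!: derivative_eq_intros)
    from has_derivative_compose[OF this assms[of "(t, x)"]] show ?thesis
      by (simp add: has_vector_derivative_def scaleR_conv_of_real)
  qed
  then show "partial_x f = fx"
    by (auto simp: partial_x_def fun_eq_iff intro!: vector_derivative_at)
qed

lemma poly_multiples_bounded:
  assumes E: "\<And>k l. bounded (range (\<lambda>p. of_real (fst p ^ k * snd p ^ l) * E p))"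
    and f: "f \<in> poly_multiples E"
  shows "bounded (range (\<lambda>p. of_real (fst p ^ k * snd p ^ l) * f p))"
  using f
proof induction
  case (monom c i j)
  have "bounded ((*) c ` range (\<lambda>p. of_real (fst p ^ (k + i) * snd p ^ (l + j)) * E p))"
    by (intro bounded_linear_image E bounded_linear_mult_right)
  then show ?case by (simp add: power_add mult_ac image_image)
next
  case (add f g)
  from bounded_plus_comp[OF this(3,4)] show ?case by (simp add: distrib_left)
qed

lemma schwartz_poly_multiples:
  assumes E: "\<And>p. (E has_derivative (\<lambda>h.
      (of_real (fst h) * (a0 + a1 * of_real (fst p) + a2 * of_real (snd p)) +
       of_real (snd h) * (b0 + b1 * of_real (fst p) + b2 * of_real (snd p))) * E p)) (at p)"
    and B: "\<And>k l. bounded (range (\<lambda>p. of_real (fst p ^ k * snd p ^ l) * E p))"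
    and f: "f \<in> poly_multiples E"
  shows "f \<in> schwartz"
proof -
  have D: "\<exists>gt \<in> poly_multiples E. \<exists>gx \<in> poly_multiples E. \<forall>p.
      (g has_derivative (\<lambda>h. of_real (fst h) * gt p + of_real (snd h) * gx p)) (at p)"
    if "g \<in> poly_multiples E" for g
    by (rule poly_multiples_deriv[OF E that])
  have pt: "partial_t g \<in> poly_multiples E" and px: "partial_x g \<in> poly_multiples E"
    and diff: "g differentiable (at p)" if g: "g \<in> poly_multiples E" for g p
  proof -
    obtain gt gx where dg: "gt \<in> poly_multiples E" "gx \<in> poly_multiples E"
      "\<And>p. (g has_derivative (\<lambda>h. of_real (fst h) * gt p + of_real (snd h) * gx p)) (at p)"
      using D[OF g] by blast
    with partials_eqI[OF dg(3)] show "partial_t g \<in> poly_multiples E" "partial_x g \<in> poly_multiples E"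
      by simp_all
    show "g differentiable (at p)" using dg(3)[of p] by (rule differentiableI)
  qed
  have "(partial_x ^^ j) f \<in> poly_multiples E" for j
    by (induction j) (auto simp: f px)
  then have "(partial_t ^^ i) ((partial_x ^^ j) f) \<in> poly_multiples E" for i j
    by (induction i) (auto simp: pt)
  with diff poly_multiples_bounded[OF B] show ?thesis
    by (simp add: schwartz_def Let_def split_def)
qed

section \<open>Wave packets and their Fourier transforms\<close>

text \<open>
  The inverse Fourier transform of the sheared Gaussian below. A shear of slope \<open>m\<close> in
  frequency is dual to the shear \<open>(t, x) \<mapsto> (t, x + m t)\<close> in space: the packet travels
  with velocity \<open>- m\<close> while it oscillates with frequency \<open>(\<alpha>, \<beta>)\<close>.
\<close>

definition packet :: "real \<Rightarrow> real \<Rightarrow> real \<Rightarrow> real \<times> real \<Rightarrow> complex" where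
  "packet m \<alpha> \<beta> = (\<lambda>(t, x). of_real (1 / (2 * pi)) * exp (\<i> * of_real (\<alpha> * t + \<beta> * x)) *
     of_real (gauss2 (t, x + m * t)))"

definition packet_hat :: "real \<Rightarrow> real \<Rightarrow> real \<Rightarrow> real \<times> real \<Rightarrow> complex" where
  "packet_hat m \<alpha> \<beta> p = of_real (gauss2 (shear m \<alpha> \<beta> p))"

text \<open>
  The substitution \<open>y = x + m t\<close> separates the variables: the phase becomes
  \<open>- t \<sigma> - y \<eta>\<close> with \<open>(\<sigma>, \<eta>) = shear m \<alpha> \<beta> (\<tau>, \<xi>)\<close>, and two one-dimensional Gaussian integrals
  remain.
\<close>

lemma fourier_packet: "fourier (packet m \<alpha> \<beta>) = packet_hat m \<alpha> \<beta>"
proof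
  fix p :: "real \<times> real"
  obtain \<tau> \<xi> where p: "p = (\<tau>, \<xi>)" by (cases p)
  obtain \<sigma> \<eta> where sh: "shear m \<alpha> \<beta> p = (\<sigma>, \<eta>)" by (cases "shear m \<alpha> \<beta> p")
  then have \<sigma>: "\<sigma> = \<tau> - \<alpha> - m * (\<xi> - \<beta>)" and \<eta>: "\<eta> = \<xi> - \<beta>" by (auto simp: shear_def p)
  define w where "w = (\<lambda>\<sigma> t. exp (- \<i> * of_real (t * \<sigma>)) * complex_of_real (gauss t))"
  have w_int: "integrable lborel (w \<sigma>)" for \<sigma>
  proof (rule Bochner_Integration.integrable_bound[OF integrable_gauss])
    show "w \<sigma> \<in> borel_measurable lborel" unfolding w_def by measurable
    show "AE t in lborel. norm (w \<sigma> t) \<le> norm (gauss t)" by (simp add: w_def norm_mult)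
  qed
  then have [measurable]: "w \<sigma> \<in> borel_measurable borel" for \<sigma>
    using borel_measurable_integrable by fastforce
  have S[measurable]: "(\<lambda>(t, x). (t, x + m * t)) \<in> lborel \<rightarrow>\<^sub>M (borel :: (real \<times> real) measure)"
    unfolding lborel_prod[symmetric] borel_prod[symmetric] by measurable
  have W[measurable]: "(\<lambda>(t, y). w \<sigma> t * w \<eta> y) \<in> borel_measurable borel"
    unfolding borel_prod[symmetric] by measurable
  have "exp (- \<i> * of_real (t * \<tau> + x * \<xi>)) * packet m \<alpha> \<beta> (t, x)
      = of_real (1 / (2 * pi)) * (w \<sigma> t * w \<eta> (x + m * t))" for t x
  proof -
    have "- \<i> * of_real (t * \<tau> + x * \<xi>) + \<i> * of_real (\<alpha> * t + \<beta> * x)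
        = - \<i> * of_real (t * \<sigma>) + - \<i> * complex_of_real ((x + m * t) * \<eta>)"
      unfolding \<sigma> \<eta> by (simp add: algebra_simps)
    then have "exp (- \<i> * of_real (t * \<tau> + x * \<xi>)) * exp (\<i> * of_real (\<alpha> * t + \<beta> * x))
        = exp (- \<i> * of_real (t * \<sigma>)) * exp (- \<i> * complex_of_real ((x + m * t) * \<eta>))"
      by (simp only: exp_add[symmetric])
    then show ?thesis
      by (simp only: packet_def w_def gauss2_def split of_real_mult mult_ac)
  qed
  then have "fourier (packet m \<alpha> \<beta>) p
      = (LINT (t, x)|lborel. of_real (1 / (2 * pi)) * (w \<sigma> t * w \<eta> (x + m * t)))"
    unfolding fourier_def p by simp
  also have "\<dots> = of_real (1 / (2 * pi)) * (LINT (t, x)|lborel. w \<sigma> t * w \<eta> (x + m * t))"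
    by (simp only: split_def integral_mult_right_zero)
  also have "(LINT (t, x)|lborel. w \<sigma> t * w \<eta> (x + m * t)) =
      (LINT (t, y)|distr lborel borel (\<lambda>(t, x). (t, x + m * t)). w \<sigma> t * w \<eta> y)"
    by (subst integral_distr[OF S W]) (simp add: split_def)
  also have "\<dots> = (LINT t|lborel. w \<sigma> t) * (LINT y|lborel. w \<eta> y)"
    unfolding distr_shear_snd by (rule integral_times[OF w_int w_int])
  also have "\<dots> = of_real (2 * pi * gauss2 (\<sigma>, \<eta>))"
    unfolding w_def fourier_gauss by (simp add: gauss2_def flip: of_real_mult)
  finally show "fourier (packet m \<alpha> \<beta>) p = packet_hat m \<alpha> \<beta> p"
    by (simp add: packet_hat_def sh)
qed

text \<open>
  The Gaussian absorbs every polynomial weight. The proof is the bound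
  \<open>ln x \<le> x - 1\<close> at \<open>x = (3 + z) / (2 Q)\<close>, where \<open>Q = P + 1\<close> avoids the degenerate exponent 0.
\<close>

lemma powr_le_exp:
  fixes P :: real
  assumes "P \<ge> 0"
  obtains C :: real where "C > 0" "\<And>z::real. z \<ge> 0 \<Longrightarrow> (3 + z) powr P \<le> C * exp (z / 2)"
proof
  define Q where "Q = P + 1"
  have Q: "Q > 0" using assms unfolding Q_def by linarith
  show "(0::real) < exp (3 / 2 - Q + Q * ln (2 * Q))" by simp
  show "(3 + z) powr P \<le> exp (3 / 2 - Q + Q * ln (2 * Q)) * exp (z / 2)" if z: "z \<ge> 0" for z :: real
  proof -
    have "ln (3 + z) - ln (2 * Q) = ln ((3 + z) / (2 * Q))"
      using Q z by (simp add: ln_div)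
    also have "\<dots> \<le> (3 + z) / (2 * Q) - 1"
      using Q z by (intro ln_le_minus_one) simp
    finally have "Q * (ln (3 + z) - ln (2 * Q)) \<le> Q * ((3 + z) / (2 * Q) - 1)"
      using Q by (intro mult_left_mono) auto
    also have "\<dots> = (3 + z) / 2 - Q" using Q by (simp add: field_simps)
    finally have "Q * ln (3 + z) \<le> 3 / 2 - Q + Q * ln (2 * Q) + z / 2"
      by (simp add: algebra_simps)
    moreover have "P * ln (3 + z) \<le> Q * ln (3 + z)"
      using z by (intro mult_right_mono) (auto simp: Q_def)
    ultimately have "P * ln (3 + z) \<le> 3 / 2 - Q + Q * ln (2 * Q) + z / 2"
      by linarith
    then show ?thesis
      using z by (simp add: powr_def exp_add[symmetric] del: mult_le_cancel_right)
  qed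
qed

lemma power_times_gauss_bounded:
  obtains B where "B > 0" "\<And>r. (1 + \<bar>r\<bar>) ^ n * gauss r \<le> B"
proof -
  obtain C where C: "C > 0" "\<And>z. z \<ge> 0 \<Longrightarrow> (3 + z) powr real n \<le> C * exp (z / 2)"
    using powr_le_exp[of "real n"] by auto
  have "(1 + \<bar>r\<bar>) ^ n * gauss r \<le> C" for r
  proof -
    have "\<bar>r\<bar> \<le> 1 + r\<^sup>2"
      using zero_le_power2[of "\<bar>r\<bar> - 1"] by (simp add: power2_diff)
    then have "(1 + \<bar>r\<bar>) ^ n \<le> (3 + r\<^sup>2) ^ n"
      by (intro power_mono) auto
    also have "\<dots> = (3 + r\<^sup>2) powr real n"
      by (simp add: powr_realpow add_pos_nonneg)
    also have "\<dots> \<le> C * exp (r\<^sup>2 / 2)" by (rule C) simp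
    finally have "(1 + \<bar>r\<bar>) ^ n * gauss r \<le> C * exp (r\<^sup>2 / 2) * gauss r"
      by (intro mult_right_mono) (auto intro: less_imp_le gauss_pos)
    also have "\<dots> = C" by (simp add: gauss_def exp_minus)
    finally show ?thesis .
  qed
  with C(1) show ?thesis using that by blast
qed

lemma packet_eq_exp:
  "packet m \<alpha> \<beta> = (\<lambda>p. of_real (1 / (2 * pi)) *
     exp (\<i> * of_real (\<alpha> * fst p + \<beta> * snd p) - of_real ((fst p)\<^sup>2 + (snd p + m * fst p)\<^sup>2) / 2))"
proof
  fix p :: "real \<times> real"
  show "packet m \<alpha> \<beta> p = of_real (1 / (2 * pi)) *
     exp (\<i> * of_real (\<alpha> * fst p + \<beta> * snd p) - of_real ((fst p)\<^sup>2 + (snd p + m * fst p)\<^sup>2) / 2)"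
  proof (cases p)
    case (Pair t x)
    have "complex_of_real (exp (- R / 2)) = exp (- (of_real R / 2))" for R
      by (simp flip: exp_of_real)
    then show ?thesis
      unfolding Pair packet_def gauss2_eq split fst_conv snd_conv
      by (simp only: diff_conv_add_uminus exp_add mult.assoc)
  qed
qed

text \<open>
  A packet is the exponential of a complex quadratic polynomial, so its logarithmic
  derivatives are affine. For the decay, \<open>\<bar>x\<bar> \<le> \<bar>y\<bar> + \<bar>m\<bar> \<bar>t\<bar>\<close> with \<open>y = x + m t\<close>, and the Gaussian decays
  in \<open>t\<close> and in \<open>y\<close>.
\<close>

lemma packet_schwartz: "packet m \<alpha> \<beta> \<in> schwartz"
proof (rule schwartz_poly_multiples)
  fix p :: "real \<times> real"
  show "(packet m \<alpha> \<beta> has_derivative (\<lambda>h.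
      (of_real (fst h) * (\<i> * of_real \<alpha> + of_real (- 1 - m\<^sup>2) * of_real (fst p) + of_real (- m) * of_real (snd p)) +
       of_real (snd h) * (\<i> * of_real \<beta> + of_real (- m) * of_real (fst p) + (- 1) * of_real (snd p))) *
      packet m \<alpha> \<beta> p)) (at p)"
  proof -
    have "((\<lambda>p. \<alpha> * fst p + \<beta> * snd p) has_derivative (\<lambda>h. \<alpha> * fst h + \<beta> * snd h)) (at p)"
      by (auto intro!: derivative_eq_intros)
    moreover have "((\<lambda>p. ((fst p)\<^sup>2 + (snd p + m * fst p)\<^sup>2)) has_derivative
        (\<lambda>h. 2 * fst p * fst h + 2 * (snd p + m * fst p) * (snd h + m * fst h))) (at p)"
      by (auto intro!: derivative_eq_intros simp: algebra_simps)
    ultimately have "((\<lambda>p. \<i> * of_real (\<alpha> * fst p + \<beta> * snd p) -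
          of_real ((fst p)\<^sup>2 + (snd p + m * fst p)\<^sup>2) / 2) has_derivative
        (\<lambda>h. \<i> * of_real (\<alpha> * fst h + \<beta> * snd h) -
          of_real (2 * fst p * fst h + 2 * (snd p + m * fst p) * (snd h + m * fst h)) / 2)) (at p)"
      by (intro has_derivative_diff has_derivative_mult_right
        bounded_linear.has_derivative[OF bounded_linear_divide] has_derivative_of_real)
    from has_derivative_mult_right[OF has_derivative_compose[OF this DERIV_exp[unfolded has_field_derivative_def]],
        of "of_real (1 / (2 * pi))"]
    show ?thesis
      unfolding packet_eq_exp
      by (rule has_derivative_eq_rhs) (auto simp: field_simps power2_eq_square)
  qed
next
  fix k l
  obtain A where A: "A > 0" "\<And>r. (1 + \<bar>r\<bar>) ^ (k + l) * gauss r \<le> A"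
    using power_times_gauss_bounded[of "k + l"] by auto
  obtain B where B: "B > 0" "\<And>r. (1 + \<bar>r\<bar>) ^ l * gauss r \<le> B"
    using power_times_gauss_bounded[of l] by auto
  show "bounded (range (\<lambda>p. of_real (fst p ^ k * snd p ^ l) * packet m \<alpha> \<beta> p))"
  proof (rule boundedI, safe)
    fix t x :: real
    define y where "y = x + m * t"
    have "\<bar>x\<bar> \<le> \<bar>y\<bar> + \<bar>m\<bar> * \<bar>t\<bar>" unfolding y_def by (simp flip: abs_mult)
    also have "\<dots> \<le> (1 + \<bar>m\<bar>) * ((1 + \<bar>t\<bar>) * (1 + \<bar>y\<bar>))"
      by (simp add: algebra_simps)
    finally have "\<bar>x\<bar> ^ l \<le> ((1 + \<bar>m\<bar>) * ((1 + \<bar>t\<bar>) * (1 + \<bar>y\<bar>))) ^ l"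
      by (intro power_mono) auto
    moreover have "\<bar>t\<bar> ^ k \<le> (1 + \<bar>t\<bar>) ^ k" by (intro power_mono) auto
    ultimately have "\<bar>t\<bar> ^ k * \<bar>x\<bar> ^ l \<le> (1 + \<bar>t\<bar>) ^ k * ((1 + \<bar>m\<bar>) * ((1 + \<bar>t\<bar>) * (1 + \<bar>y\<bar>))) ^ l"
      by (intro mult_mono) auto
    then have "\<bar>t\<bar> ^ k * \<bar>x\<bar> ^ l * (gauss t * gauss y) \<le>
        (1 + \<bar>t\<bar>) ^ k * ((1 + \<bar>m\<bar>) * ((1 + \<bar>t\<bar>) * (1 + \<bar>y\<bar>))) ^ l * (gauss t * gauss y)"
      using gauss_pos[of t] gauss_pos[of y] by (intro mult_right_mono) auto
    also have "\<dots> = (1 + \<bar>m\<bar>) ^ l * (((1 + \<bar>t\<bar>) ^ (k + l) * gauss t) * ((1 + \<bar>y\<bar>) ^ l * gauss y))"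
      by (simp add: power_add power_mult_distrib)
    also have "\<dots> \<le> (1 + \<bar>m\<bar>) ^ l * (A * B)"
      using gauss_pos[of t] gauss_pos[of y] A B
      by (intro mult_left_mono mult_mono) (auto intro: less_imp_le)
    finally have *: "\<bar>t\<bar> ^ k * \<bar>x\<bar> ^ l * gauss2 (t, y) \<le> (1 + \<bar>m\<bar>) ^ l * (A * B)"
      by (simp add: gauss2_def)
    have "norm (packet m \<alpha> \<beta> (t, x)) = 1 / (2 * pi) * gauss2 (t, y)"
      using gauss2_pos[of "(t, y)"] by (simp add: packet_def norm_mult norm_divide y_def)
    also have "\<dots> \<le> 1 * gauss2 (t, y)"
      using gauss2_pos[of "(t, y)"] pi_gt3 by (intro mult_right_mono) (auto intro: less_imp_le)
    finally have "\<bar>t\<bar> ^ k * \<bar>x\<bar> ^ l * norm (packet m \<alpha> \<beta> (t, x)) \<le> \<bar>t\<bar> ^ k * \<bar>x\<bar> ^ l * gauss2 (t, y)"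
      by (intro mult_left_mono) auto
    with * show "norm (of_real (fst (t, x) ^ k * snd (t, x) ^ l) * packet m \<alpha> \<beta> (t, x)) \<le> (1 + \<bar>m\<bar>) ^ l * (A * B)"
      by (simp add: norm_mult norm_power)
  qed
next
  have "(\<lambda>p. 1 * of_real (fst p ^ 0 * snd p ^ 0) * packet m \<alpha> \<beta> p) \<in> poly_multiples (packet m \<alpha> \<beta>)"
    by (rule poly_multiples.monom)
  then show "packet m \<alpha> \<beta> \<in> poly_multiples (packet m \<alpha> \<beta>)" by simp
qed

lemma packet_hat_measurable [measurable]: "packet_hat m \<alpha> \<beta> \<in> borel_measurable borel"
  unfolding packet_hat_def[abs_def] by measurable

text \<open>
  The constant sequence serves as approximation, because \<open>packet_hat\<close> is itself the transform of
  a Schwartz function.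
\<close>

lemma packet_hat_X_space: "packet_hat m \<alpha> \<beta> \<in> X_space s b"
  unfolding X_space_def
  by (auto intro!: exI[where x = "\<lambda>_. packet m \<alpha> \<beta>"] packet_schwartz
      simp: fourier_packet X_norm_def ennsqrt_def split_def)

section \<open>Upper bound for the norm of a packet\<close>

lemma disp_nonneg: "0 \<le> disp \<xi>"
  by (simp add: disp_def)

text \<open>
  The square of the dispersion is \<open>\<xi>\<^sup>2 + \<xi>\<^sup>4\<close>, which lies between \<open>(\<xi>\<^sup>2)\<^sup>2\<close> and \<open>(\<xi>\<^sup>2 + 1 / 2)\<^sup>2\<close>.
\<close>

lemma disp_near_square: "\<bar>disp \<xi> - \<xi>\<^sup>2\<bar> \<le> 1 / 2"
proof -
  have "\<xi>\<^sup>2 \<le> disp \<xi>"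
    unfolding disp_def by (rule real_le_rsqrt) (simp add: power_mult[symmetric])
  moreover have "disp \<xi> \<le> \<xi>\<^sup>2 + 1 / 2"
    unfolding disp_def
    by (rule real_le_lsqrt) (auto simp: power2_sum power_mult[symmetric])
  ultimately show ?thesis by simp
qed

lemma ennsqrt_mono: "x \<le> y \<Longrightarrow> ennsqrt x \<le> ennsqrt y"
  by (auto simp: ennsqrt_def top_unique enn2real_mono less_top intro!: ennreal_leI)

lemma ennsqrt_power2: "0 \<le> r \<Longrightarrow> ennsqrt (ennreal (r\<^sup>2)) = ennreal r"
  by (simp add: ennsqrt_def)

lemma japanese_ge_1: "1 \<le> japanese r"
  by (simp add: japanese_def)

text \<open>
  In the coordinates \<open>(\<sigma>, \<eta>)\<close> adapted to the packet, \<open>e \<tau> = e \<sigma> + \<xi>\<^sup>2 - \<eta>\<^sup>2\<close>: leaving the tangent line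
  costs \<open>\<sigma>\<close>, and the tangent leaves the parabola by \<open>\<eta>\<^sup>2\<close>. So the modulation is
  at most \<open>\<bar>\<sigma>\<bar> + \<eta>\<^sup>2 + 1 / 2\<close>, uniformly in \<open>N\<close>. The weight in \<open>\<xi>\<close> is handled by
  \<open>N \<le> \<bar>\<xi>\<bar> + \<bar>\<eta>\<bar> \<le> (1 + \<bar>\<xi>\<bar>) (1 + \<bar>\<eta>\<bar>)\<close>, which for \<open>s \<le> 0\<close> turns \<open>\<langle>\<xi>\<rangle>\<^sup>s\<close> into \<open>N\<^sup>s\<close> at the cost of
  a polynomial in \<open>\<eta>\<close>. The sign \<open>e\<close> treats both branches of \<open>\<bar>\<tau>\<bar> = \<gamma>(\<xi>)\<close> together.
\<close>

lemma packet_hat_weight_bound: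
  fixes e :: real
  assumes N: "N \<ge> 1" and e: "e = 1 \<or> e = -1" and s: "s \<le> 0"
    and sh: "shear (2 * N) (e * N\<^sup>2) (e * N) (\<tau>, \<xi>) = (\<sigma>, \<eta>)"
  defines "z \<equiv> \<sigma>\<^sup>2 + \<eta>\<^sup>2"
  shows "japanese (\<bar>\<tau>\<bar> - disp \<xi>) powr b * japanese \<xi> powr s
    \<le> N powr s * (3 + z) powr (\<bar>b\<bar> - s)"
proof -
  have \<eta>: "\<xi> = e * N + \<eta>" and \<sigma>: "\<tau> = \<sigma> + e * N\<^sup>2 + 2 * N * \<eta>"
    using sh by (auto simp: shear_def)
  have z: "z \<ge> 0" by (simp add: z_def)
  have abs_le: "\<bar>r\<bar> \<le> 1 / 2 + r\<^sup>2 / 2" for r :: real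
    using zero_le_power2[of "\<bar>r\<bar> - 1"] by (simp add: power2_diff)
  have e2: "e * e = 1" using e by auto
  have "e * \<tau> = e * \<sigma> + \<xi>\<^sup>2 - \<eta>\<^sup>2"
    using e2 unfolding \<eta> \<sigma> by (simp add: power2_eq_square algebra_simps)
  moreover have "\<bar>e * \<tau>\<bar> = \<bar>\<tau>\<bar>" "\<bar>e * \<sigma>\<bar> = \<bar>\<sigma>\<bar>" using e by auto
  ultimately have "\<bar>\<bar>\<tau>\<bar> - disp \<xi>\<bar> \<le> \<bar>\<sigma>\<bar> + \<eta>\<^sup>2 + 1 / 2"
    using disp_near_square[of \<xi>] disp_nonneg[of \<xi>] zero_le_power2[of \<eta>] by linarith
  then have J: "japanese (\<bar>\<tau>\<bar> - disp \<xi>) \<le> 3 + z"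
    using abs_le[of \<sigma>] zero_le_power2[of \<sigma>] unfolding japanese_def z_def by linarith
  have "japanese (\<bar>\<tau>\<bar> - disp \<xi>) powr b \<le> japanese (\<bar>\<tau>\<bar> - disp \<xi>) powr \<bar>b\<bar>"
    by (intro powr_mono japanese_ge_1) simp
  also have "\<dots> \<le> (3 + z) powr \<bar>b\<bar>"
    using J japanese_ge_1[of "\<bar>\<tau>\<bar> - disp \<xi>"] by (intro powr_mono2) auto
  finally have b: "japanese (\<bar>\<tau>\<bar> - disp \<xi>) powr b \<le> (3 + z) powr \<bar>b\<bar>" .
  have "N \<le> \<bar>\<xi>\<bar> + \<bar>\<eta>\<bar>" using e N unfolding \<eta> by auto
  also have "\<dots> \<le> (1 + \<bar>\<xi>\<bar>) * (1 + \<bar>\<eta>\<bar>)" by (simp add: algebra_simps)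
  also have "\<dots> \<le> japanese \<xi> * (3 + z)"
    using abs_le[of \<eta>] zero_le_power2[of \<sigma>] zero_le_power2[of \<eta>]
    unfolding japanese_def z_def by (intro mult_left_mono) linarith+
  finally have "N / (3 + z) \<le> japanese \<xi>" using z by (simp add: divide_le_eq)
  then have "japanese \<xi> powr s \<le> (N / (3 + z)) powr s"
    using N z s by (intro powr_mono2') auto
  also have "\<dots> = N powr s * (3 + z) powr (- s)"
    using N z by (simp add: powr_divide powr_minus_divide)
  finally have "japanese (\<bar>\<tau>\<bar> - disp \<xi>) powr b * japanese \<xi> powr s
      \<le> (3 + z) powr \<bar>b\<bar> * (N powr s * (3 + z) powr (- s))"
    using b by (intro mult_mono) auto
  then show ?thesis by (simp add: powr_diff powr_minus_divide mult_ac)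
qed

text \<open>
  The polynomial loss in the weight is absorbed by half of the squared Gaussian, and the shear
  removes \<open>N\<close> from the remaining integral.
\<close>

lemma X_norm_packet_hat_le:
  assumes s: "s \<le> 0"
  obtains K where "K > 0"
    "\<And>N e. N \<ge> 1 \<Longrightarrow> e = 1 \<or> e = -1 \<Longrightarrow>
       X_norm s b (packet_hat (2 * N) (e * N\<^sup>2) (e * N)) \<le> ennreal (K * N powr s)"
proof -
  obtain C where C: "C > 0" "\<And>z. z \<ge> 0 \<Longrightarrow> (3 + z) powr (2 * (\<bar>b\<bar> - s)) \<le> C * exp (z / 2)"
    by (rule powr_le_exp[of "2 * (\<bar>b\<bar> - s)"]) (use s in auto)
  define I where "I = (LINT p|lborel. gauss2 p)"
  have I: "I \<ge> 0" unfolding I_def by (intro Bochner_Integration.integral_nonneg) (simp add: gauss2_pos less_imp_le)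
  have "X_norm s b (packet_hat (2 * N) (e * N\<^sup>2) (e * N)) \<le> ennreal ((sqrt (C * I) + 1) * N powr s)"
    if N: "N \<ge> 1" and e: "e = 1 \<or> e = -1" for N e :: real
  proof -
    let ?S = "shear (2 * N) (e * N\<^sup>2) (e * N)"
    have "(\<integral>\<^sup>+ (\<tau>, \<xi>). ennreal ((japanese (\<bar>\<tau>\<bar> - disp \<xi>) powr b * japanese \<xi> powr s *
        cmod (packet_hat (2 * N) (e * N\<^sup>2) (e * N) (\<tau>, \<xi>)))\<^sup>2) \<partial>lborel)
      \<le> (\<integral>\<^sup>+ p. ennreal (C * (N powr s)\<^sup>2) * ennreal (gauss2 (?S p)) \<partial>lborel)"
    proof (intro nn_integral_mono, clarify)
      fix \<tau> \<xi> :: real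
      obtain \<sigma> \<eta> where sh: "?S (\<tau>, \<xi>) = (\<sigma>, \<eta>)" by (cases "?S (\<tau>, \<xi>)")
      define z where "z = \<sigma>\<^sup>2 + \<eta>\<^sup>2"
      have g: "gauss2 (\<sigma>, \<eta>) = exp (- z / 2)" by (simp add: gauss2_eq z_def)
      have "(japanese (\<bar>\<tau>\<bar> - disp \<xi>) powr b * japanese \<xi> powr s *
          cmod (packet_hat (2 * N) (e * N\<^sup>2) (e * N) (\<tau>, \<xi>)))\<^sup>2
        \<le> (N powr s * (3 + z) powr (\<bar>b\<bar> - s) * exp (- z / 2))\<^sup>2"
        using packet_hat_weight_bound[OF N e s sh, of b]
        by (intro power_mono mult_nonneg_nonneg) (auto simp: packet_hat_def sh g z_def intro!: mult_right_mono)
      also have "\<dots> = (N powr s)\<^sup>2 * ((3 + z) powr (2 * (\<bar>b\<bar> - s)) * (exp (- z / 2) * exp (- z / 2)))"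
      proof -
        have "(3 + z) powr (2 * (\<bar>b\<bar> - s)) = ((3 + z) powr (\<bar>b\<bar> - s))\<^sup>2"
          by (simp add: power2_eq_square flip: powr_add)
        then show ?thesis by (simp only: power_mult_distrib power2_eq_square[of "exp _"] mult.assoc)
      qed
      also have "\<dots> \<le> (N powr s)\<^sup>2 * (C * exp (z / 2) * (exp (- z / 2) * exp (- z / 2)))"
        by (intro mult_left_mono mult_right_mono C) (auto simp: z_def)
      also have "\<dots> = C * (N powr s)\<^sup>2 * gauss2 (\<sigma>, \<eta>)"
        by (simp add: g exp_minus)
      finally show "ennreal ((japanese (\<bar>\<tau>\<bar> - disp \<xi>) powr b * japanese \<xi> powr s *
          cmod (packet_hat (2 * N) (e * N\<^sup>2) (e * N) (\<tau>, \<xi>)))\<^sup>2)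
        \<le> ennreal (C * (N powr s)\<^sup>2) * ennreal (gauss2 (?S (\<tau>, \<xi>)))"
        using C(1) gauss2_pos[of "(\<sigma>, \<eta>)"] by (simp add: sh ennreal_mult'[symmetric] ennreal_leI)
    qed
    also have "\<dots> = ennreal (C * (N powr s)\<^sup>2) * (\<integral>\<^sup>+ p. ennreal (gauss2 (?S p)) \<partial>lborel)"
      by (rule nn_integral_cmult) measurable
    also have "(\<integral>\<^sup>+ p. ennreal (gauss2 (?S p)) \<partial>lborel) = (\<integral>\<^sup>+ p. ennreal (gauss2 p) \<partial>distr lborel borel ?S)"
      by (rule nn_integral_distr[symmetric]) measurable
    also have "\<dots> = ennreal I"
      unfolding distr_shear I_def
      by (intro nn_integral_eq_integral integrable_gauss2) (simp add: gauss2_pos less_imp_le)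
    also have "ennreal (C * (N powr s)\<^sup>2) * ennreal I = ennreal ((sqrt (C * I) * N powr s)\<^sup>2)"
      using C(1) I by (simp add: ennreal_mult'[symmetric] power_mult_distrib mult_ac)
    finally have "X_norm s b (packet_hat (2 * N) (e * N\<^sup>2) (e * N)) \<le> ennreal (sqrt (C * I) * N powr s)"
      unfolding X_norm_def using C(1) I by (subst ennsqrt_power2[symmetric]) (auto intro: ennsqrt_mono)
    \<comment> \<open>Enlarging the constant by 1 makes it positive without any lower bound on \<open>I\<close>.\<close>
    also have "\<dots> \<le> ennreal ((sqrt (C * I) + 1) * N powr s)"
      by (intro ennreal_leI mult_right_mono) auto
    finally show ?thesis .
  qed
  moreover have "sqrt (C * I) + 1 > 0" using C(1) I by (intro add_nonneg_pos) auto
  ultimately show ?thesis using that by blast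
qed

section \<open>Lower bound for the interaction of two packets\<close>

definition gauss2_conv :: "real \<times> real \<Rightarrow> real" where
  "gauss2_conv r = (LINT q|lborel. gauss2 q * gauss2 (r - q))"

text \<open>
  The centres of the two packets cancel and the shears have the same slope, so in sheared
  coordinates this is a fixed convolution of Gaussians, into which the packets enter through
  their slope alone.
\<close>

lemma prod_hat_packets:
  "prod_hat (packet_hat m \<alpha> \<beta>) (packet_hat m (- \<alpha>) (- \<beta>)) p =
     of_real (gauss2_conv (shear m 0 0 p) / (2 * pi)\<^sup>2)"
proof -
  define f where "f = (\<lambda>q. complex_of_real (gauss2 q * gauss2 (shear m 0 0 p - q)))"
  have f: "f \<in> borel_measurable borel" unfolding f_def by measurable
  have "shear m (- \<alpha>) (- \<beta>) (p - q) = shear m 0 0 p - shear m \<alpha> \<beta> q" for q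
    by (cases p, cases q) (simp add: shear_def algebra_simps)
  then have "(LINT q|lborel. packet_hat m \<alpha> \<beta> q * packet_hat m (- \<alpha>) (- \<beta>) (p - q))
      = (LINT q|lborel. f (shear m \<alpha> \<beta> q))"
    by (simp add: packet_hat_def f_def)
  also have "\<dots> = (LINT q|distr lborel borel (shear m \<alpha> \<beta>). f q)"
    using f by (intro integral_distr[symmetric]) auto
  also have "\<dots> = of_real (gauss2_conv (shear m 0 0 p))"
    unfolding distr_shear f_def gauss2_conv_def by (rule integral_complex_of_real)
  finally show ?thesis by (simp add: prod_hat_def)
qed

lemma emeasure_lborel_Times:
  "A \<in> sets borel \<Longrightarrow> B \<in> sets borel \<Longrightarrow>
    emeasure lborel (A \<times> B) = emeasure lborel A * emeasure (lborel :: real measure) (B :: real set)"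
  for A :: "real set"
  by (simp flip: lborel_prod add: lborel.emeasure_pair_measure_Times)

lemma emeasure_unit_square:
  fixes u v :: real
  shows "emeasure lborel ({u..u + 1} \<times> {v..v + 1}) = 1"
  by (subst emeasure_lborel_Times) auto

text \<open>
  For \<open>q\<close> in the unit square, \<open>gauss2 q \<ge> exp (- 1)\<close>; and \<open>r - q\<close> has coordinates of modulus at most 1
  and 2, so \<open>gauss2 (r - q) \<ge> exp (- 5 / 2)\<close>.
\<close>

lemma gauss2_conv_ge:
  assumes "r \<in> {0..1} \<times> {1..2}"
  shows "gauss2_conv r \<ge> exp (- 7 / 2)"
proof -
  have m [measurable]: "(\<lambda>q. gauss2 q * gauss2 (r - q)) \<in> borel_measurable lborel" by measurable
  have "exp (- 7 / 2) = (LINT q|lborel. exp (- 7 / 2) * indicator ({0..1} \<times> {0..1} :: (real \<times> real) set) q :: real)"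
    using emeasure_unit_square[of 0 0] by (simp add: measure_def)
  also have "\<dots> \<le> gauss2_conv r"
    unfolding gauss2_conv_def
  proof (rule integral_mono)
    show "integrable lborel (\<lambda>q. exp (- 7 / 2) * indicator ({0..1} \<times> {0..1} :: (real \<times> real) set) q :: real)"
      by (intro integrable_mult_right integrable_real_indicator) (use emeasure_unit_square[of 0 0] in \<open>auto intro: borel_Times\<close>)
    show "integrable lborel (\<lambda>q. gauss2 q * gauss2 (r - q))"
    proof (rule Bochner_Integration.integrable_bound[OF integrable_gauss2 m])
      show "AE q in lborel. norm (gauss2 q * gauss2 (r - q)) \<le> norm (gauss2 q)"
        using gauss2_pos gauss2_le_1 by (simp add: abs_mult abs_of_pos mult_left_le)
    qed
    fix q :: "real \<times> real"
    show "exp (- 7 / 2) * indicator ({0..1} \<times> {0..1}) q \<le> gauss2 q * gauss2 (r - q)"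
    proof (cases "q \<in> ({0..1} \<times> {0..1})")
      case True
      obtain x y where q: "q = (x, y)" by (cases q)
      obtain u v where r: "r = (u, v)" by (cases r)
      have gauss_arg: "- 7 / 2 \<le> - (A + B) / 2 + - (C + D) / 2" if "A \<le> 1" "B \<le> 1" "C \<le> 1" "D \<le> 4"
        for A B C D :: real
        using that by (simp add: field_simps)
      have "0 \<le> x" "x \<le> 1" "0 \<le> y" "y \<le> 1" "0 \<le> u" "u \<le> 1" "1 \<le> v" "v \<le> 2"
        using True assms by (auto simp: q r)
      then have "\<bar>x\<bar> \<le> \<bar>1\<bar>" "\<bar>y\<bar> \<le> \<bar>1\<bar>" "\<bar>u - x\<bar> \<le> \<bar>1\<bar>" "\<bar>v - y\<bar> \<le> \<bar>2\<bar>"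
        by linarith+
      then have "x\<^sup>2 \<le> 1" "y\<^sup>2 \<le> 1" "(u - x)\<^sup>2 \<le> 1" "(v - y)\<^sup>2 \<le> 4"
        unfolding abs_le_square_iff by simp_all
      then have "- 7 / 2 \<le> - (x\<^sup>2 + y\<^sup>2) / 2 + - ((u - x)\<^sup>2 + (v - y)\<^sup>2) / 2"
        by (rule gauss_arg)
      then show ?thesis
        using True by (simp add: q r gauss2_eq flip: exp_add)
    qed (simp add: gauss2_pos less_imp_le)
  qed
  finally show ?thesis .
qed

text \<open>
  It suffices to integrate over the parallelogram of area 1 that consists of the points with
  \<open>1 \<le> \<xi> \<le> 2\<close> and \<open>0 \<le> \<tau> - 2 N \<xi> \<le> 1\<close>. On it the modulation weight lies between \<open>N\<close> and
  \<open>5 N\<close>. Both bounds are needed, since the exponent \<open>- a\<close> may have either sign.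
\<close>

lemma X_norm_bilinear_packets_ge:
  assumes s: "s \<le> 0"
  obtains \<kappa> where "\<kappa> > 0"
    "\<And>N. N \<ge> 6 \<Longrightarrow> ennreal (\<kappa> * N powr (- a)) \<le>
       X_norm s (- a) (bilinear_hat (packet_hat (2 * N) (N\<^sup>2) N) (packet_hat (2 * N) (- (N\<^sup>2)) (- N)))"
proof -
  define \<delta> :: real where "\<delta> = exp (- 7 / 2) / (2 * pi)\<^sup>2 / 4"
  define \<kappa> where "\<kappa> = 5 powr (- \<bar>a\<bar>) * 3 powr s * \<delta>"
  have \<delta>: "\<delta> > 0" and \<kappa>: "\<kappa> > 0" unfolding \<kappa>_def \<delta>_def by simp_all
  have "ennreal (\<kappa> * N powr (- a)) \<le>
       X_norm s (- a) (bilinear_hat (packet_hat (2 * N) (N\<^sup>2) N) (packet_hat (2 * N) (- (N\<^sup>2)) (- N)))"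
    (is "_ \<le> X_norm s (- a) ?B") if N: "N \<ge> 6" for N
  proof -
    let ?Q = "{0..1} \<times> {1..2} :: (real \<times> real) set"
    let ?S = "shear (2 * N) 0 0"
    have Q: "?Q \<in> sets borel" by (intro borel_Times) auto
    have pointwise: "\<kappa> * N powr (- a) \<le>
        japanese (\<bar>\<tau>\<bar> - disp \<xi>) powr (- a) * japanese \<xi> powr s * cmod (?B (\<tau>, \<xi>))"
      if "?S (\<tau>, \<xi>) \<in> ?Q" for \<tau> \<xi>
    proof -
      have \<xi>: "1 \<le> \<xi>" "\<xi> \<le> 2" and \<tau>: "2 * N * \<xi> \<le> \<tau>" "\<tau> \<le> 2 * N * \<xi> + 1"
        using that by (auto simp: shear_def)
      have \<xi>2: "1 \<le> \<xi>\<^sup>2" "\<xi>\<^sup>2 \<le> 4"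
        using power_mono[of 1 \<xi> 2] power_mono[of \<xi> 2 2] \<xi> by simp_all
      have disp: "disp \<xi> \<le> 2 * \<xi>\<^sup>2" "disp \<xi> \<le> 9 / 2" "disp \<xi> > 0"
        using disp_near_square[of \<xi>] \<xi>2 by linarith+
      define J where "J = japanese (\<bar>\<tau>\<bar> - disp \<xi>)"
      have "2 * N * 1 \<le> 2 * N * \<xi>" "2 * N * \<xi> \<le> 2 * N * 2"
        using N \<xi> by (intro mult_left_mono; simp)+
      \<comment> \<open>Since \<open>\<tau>\<close> lies in \<open>[2 N, 4 N + 1]\<close> and \<open>\<gamma>(\<xi>)\<close> in \<open>(0, 9 / 2]\<close>, \<open>2 N - 7 / 2 \<le> J \<le> 4 N + 2\<close>.\<close>
      then have J: "N \<le> J" "J \<le> 5 * N"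
        using \<tau> N disp unfolding J_def japanese_def by linarith+
      have "5 powr (- \<bar>a\<bar>) \<le> (J / N) powr (- \<bar>a\<bar>)"
        using J N by (intro powr_mono2') (auto simp: divide_le_eq)
      also have "\<dots> \<le> (J / N) powr (- a)"
        using J N by (intro powr_mono) auto
      also have "\<dots> = J powr (- a) / N powr (- a)"
        using J N by (simp add: powr_divide)
      finally have w1: "5 powr (- \<bar>a\<bar>) * N powr (- a) \<le> J powr (- a)"
        using N by (simp add: le_divide_eq)
      have w2: "3 powr s \<le> japanese \<xi> powr s"
        using \<xi> s by (intro powr_mono2') (auto simp: japanese_def)
      have "\<delta> = 1 / 4 * (exp (- 7 / 2) / (2 * pi)\<^sup>2)" by (simp add: \<delta>_def)
      also have "\<dots> \<le> (\<bar>\<xi>\<bar>\<^sup>2 / (2 * disp \<xi>)) * (gauss2_conv (?S (\<tau>, \<xi>)) / (2 * pi)\<^sup>2)"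
        using disp gauss2_conv_ge[OF that]
        by (intro mult_mono divide_right_mono) (auto simp: le_divide_eq)
      also have "\<dots> = cmod (?B (\<tau>, \<xi>))"
      proof -
        have "gauss2_conv (?S (\<tau>, \<xi>)) > 0"
          using gauss2_conv_ge[OF that] by (rule less_le_trans[rotated]) simp
        then show ?thesis
          using disp(3)
          by (simp add: bilinear_hat_def prod_hat_packets norm_mult norm_divide norm_power)
      qed
      finally have "5 powr (- \<bar>a\<bar>) * N powr (- a) * 3 powr s * \<delta> \<le> J powr (- a) * japanese \<xi> powr s * cmod (?B (\<tau>, \<xi>))"
        using \<delta> w1 w2 by (intro mult_mono) auto
      then show ?thesis by (simp add: \<kappa>_def J_def mult_ac)
    qed
    have "ennreal ((\<kappa> * N powr (- a))\<^sup>2) = (\<integral>\<^sup>+ p. ennreal ((\<kappa> * N powr (- a))\<^sup>2) * indicator ?Q p \<partial>distr lborel borel ?S)"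
      unfolding distr_shear using Q emeasure_unit_square[of 0 1]
      by (subst nn_integral_cmult_indicator) auto
    also have "\<dots> = (\<integral>\<^sup>+ p. ennreal ((\<kappa> * N powr (- a))\<^sup>2) * indicator ?Q (?S p) \<partial>lborel)"
      using Q by (intro nn_integral_distr) auto
    also have "\<dots> \<le> (\<integral>\<^sup>+ (\<tau>, \<xi>). ennreal ((japanese (\<bar>\<tau>\<bar> - disp \<xi>) powr (- a) * japanese \<xi> powr s *
        cmod (?B (\<tau>, \<xi>)))\<^sup>2) \<partial>lborel)"
    proof (intro nn_integral_mono, clarify)
      fix \<tau> \<xi> :: real
      show "ennreal ((\<kappa> * N powr (- a))\<^sup>2) * indicator ?Q (?S (\<tau>, \<xi>)) \<le>
        ennreal ((japanese (\<bar>\<tau>\<bar> - disp \<xi>) powr (- a) * japanese \<xi> powr s * cmod (?B (\<tau>, \<xi>)))\<^sup>2)"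
        using \<kappa> by (cases "?S (\<tau>, \<xi>) \<in> ?Q")
          (auto intro!: ennreal_leI power_mono pointwise simp del: mem_Times_iff)
    qed
    finally show ?thesis
      unfolding X_norm_def using \<kappa> by (subst ennsqrt_power2[symmetric]) (auto intro: ennsqrt_mono)
  qed
  with \<kappa> show ?thesis using that by blast
qed

section \<open>Failure of the bilinear estimate\<close>

theorem theorem1p2:
  fixes s a b :: real
  assumes "s \<le> - 1 / 4" and "a < 1 / 2"
  shows "\<not> (\<exists>c::real. c > 0 \<and>
    (\<forall>U \<in> X_space s b. \<forall>V \<in> X_space s b.
      X_norm s (- a) (bilinear_hat U V) \<le> ennreal c * X_norm s b U * X_norm s b V))"
proof
  assume "\<exists>c::real. c > 0 \<and>
    (\<forall>U \<in> X_space s b. \<forall>V \<in> X_space s b.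
      X_norm s (- a) (bilinear_hat U V) \<le> ennreal c * X_norm s b U * X_norm s b V)"
  then obtain c where c: "c > 0" and
    est: "\<And>U V. U \<in> X_space s b \<Longrightarrow> V \<in> X_space s b \<Longrightarrow>
      X_norm s (- a) (bilinear_hat U V) \<le> ennreal c * X_norm s b U * X_norm s b V"
    by blast
  have s: "s \<le> 0" using assms by simp
  obtain K where K: "K > 0" and upper: "\<And>N e. N \<ge> 1 \<Longrightarrow> e = 1 \<or> e = -1 \<Longrightarrow>
       X_norm s b (packet_hat (2 * N) (e * N\<^sup>2) (e * N)) \<le> ennreal (K * N powr s)"
    using X_norm_packet_hat_le[OF s, of b] by blast
  obtain \<kappa> where \<kappa>: "\<kappa> > 0" and lower: "\<And>N. N \<ge> 6 \<Longrightarrow> ennreal (\<kappa> * N powr (- a)) \<le>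
       X_norm s (- a) (bilinear_hat (packet_hat (2 * N) (N\<^sup>2) N) (packet_hat (2 * N) (- (N\<^sup>2)) (- N)))"
    using X_norm_bilinear_packets_ge[OF s, of a] by blast
  have bound: "N powr (- a - 2 * s) \<le> c * K\<^sup>2 / \<kappa>" if N: "N \<ge> 6" for N
  proof -
    have "ennreal (\<kappa> * N powr (- a)) \<le> ennreal c * X_norm s b (packet_hat (2 * N) (N\<^sup>2) N) *
        X_norm s b (packet_hat (2 * N) (- (N\<^sup>2)) (- N))"
      using lower[OF N] est[OF packet_hat_X_space packet_hat_X_space] by (rule order_trans)
    also have "\<dots> \<le> ennreal c * ennreal (K * N powr s) * ennreal (K * N powr s)"
      using upper[of N 1] upper[of N "-1"] N by (intro mult_mono) auto
    also have "\<dots> = ennreal (c * K\<^sup>2 * N powr (2 * s))"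
    proof -
      have "N powr (2 * s) = N powr s * N powr s" by (simp flip: powr_add)
      then show ?thesis
        using c K by (simp add: ennreal_mult'[symmetric] power2_eq_square mult_ac)
    qed
    finally have "\<kappa> * N powr (- a) \<le> c * K\<^sup>2 * N powr (2 * s)"
      using c K by (subst (asm) ennreal_le_iff) auto
    then show ?thesis
      using \<kappa> N by (simp add: powr_diff divide_le_eq le_divide_eq mult_ac)
  qed
  have exponent: "- a - 2 * s > 0" using assms by simp
  define M where "M = c * K\<^sup>2 / \<kappa>"
  \<comment> \<open>The second argument of the maximum solves \<open>N powr (- a - 2 * s) = M + 1\<close>.\<close>
  define N where "N = max 6 ((M + 1) powr (1 / (- a - 2 * s)))"
  have "M \<ge> 0" unfolding M_def using c \<kappa> by (intro divide_nonneg_nonneg) auto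
  then have "M + 1 = ((M + 1) powr (1 / (- a - 2 * s))) powr (- a - 2 * s)"
    using exponent by (simp add: powr_powr)
  also have "\<dots> \<le> N powr (- a - 2 * s)"
    using exponent by (intro powr_mono2) (auto simp: N_def)
  finally have "M + 1 \<le> N powr (- a - 2 * s)" .
  moreover have "N powr (- a - 2 * s) \<le> M"
    unfolding M_def by (rule bound) (simp add: N_def)
  ultimately show False by simp
qed

end
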